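(* Let $n > 2$, let $\theta : \mathbb{Z} \to Aut(\mathbb{Q}^n)$ be a homomorphism, and let $M \in GL_n(\mathbb{Q})$ be the matrix of $\theta(1)$. Then the Reidemeister spectrum of $\mathbb{Q}^n \rtimes_\theta \mathbb{Z}$ is either $\{\infty\}$ or $\{2\} \cup \{\infty\}$. More precisely, $Spec(\mathbb{Q}^n \rtimes_\theta \mathbb{Z}) = \{\infty\}$ if there is no invertible $n \times n$ matrix $N$ over $\mathbb{Q}$ such that $N = MNM$ and both $\det(Id - N)$ and $\det(Id - MN)$ are nonzero; otherwise $Spec(\mathbb{Q}^n \rtimes_\theta \mathbb{Z}) = \{2\} \cup \{\infty\}$.
   Context: For an automorphism $\phi$ of a group $G$, the Reidemeister (twisted conjugacy) classes of $\phi$ are the equivalence classes of the relation $x \sim g x \phi(g^{-1})$, $x, g \in G$, and the Reidemeister number $R(\phi)$ is the number of these classes (a positive integer or $\infty$). The Reidemeister spectrum is $Spec(G) = \{R(\phi) \mid \phi \in Aut(G)\} \subseteq \mathbb{N} \cup \{\infty\}$. $\mathbb{Q}^n$ is regarded as an additive group; its automorphisms are exactly the $\mathbb{Q}$-linear ones. $\mathbb{Q}^n \rtimes_\theta \mathbb{Z}$ is the semidirect product in which the generator $1 \in \mathbb{Z}$ acts on $\mathbb{Q}^n$ by $\theta(1)$. $Id$ is the identity matrix. *)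

theory Defs
  imports "HOL-Analysis.Analysis" "HOL-Algebra.Algebra" "HOL-Library.Extended_Nat"
begin

definition reidemeister_rel :: "('a, 'b) monoid_scheme \<Rightarrow> ('a \<Rightarrow> 'a) \<Rightarrow> ('a \<times> 'a) set" where
  "reidemeister_rel G \<phi> =
     {(x, y). x \<in> carrier G \<and> y \<in> carrier G \<and>
        (\<exists>g\<in>carrier G. y = g \<otimes>\<^bsub>G\<^esub> x \<otimes>\<^bsub>G\<^esub> \<phi> (inv\<^bsub>G\<^esub> g))}"

definition reidemeister_number :: "('a, 'b) monoid_scheme \<Rightarrow> ('a \<Rightarrow> 'a) \<Rightarrow> enat" where
  "reidemeister_number G \<phi> =
     (let C = carrier G // reidemeister_rel G \<phi>
      in if finite C then enat (card C) else \<infinity>)"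

text \<open>\<^term>\<open>auto G\<close> (from HOL-Algebra) consists of the automorphisms that are extensional on the
  carrier; \<^const>\<open>reidemeister_number\<close> only depends on the values there, so nothing is lost.\<close>

definition reidemeister_spectrum :: "('a, 'b) monoid_scheme \<Rightarrow> enat set" where
  "reidemeister_spectrum G = {reidemeister_number G \<phi> | \<phi>. \<phi> \<in> auto G}"

definition semidirect_product ::
  "('a, 'c) monoid_scheme \<Rightarrow> ('b, 'd) monoid_scheme \<Rightarrow> ('b \<Rightarrow> 'a \<Rightarrow> 'a) \<Rightarrow> ('a \<times> 'b) monoid" where
  "semidirect_product A H \<theta> =
     \<lparr>carrier = carrier A \<times> carrier H,
      monoid.mult = (\<lambda>(a, h) (b, k). (a \<otimes>\<^bsub>A\<^esub> \<theta> h b, h \<otimes>\<^bsub>H\<^esub> k)),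
      one = (\<one>\<^bsub>A\<^esub>, \<one>\<^bsub>H\<^esub>)\<rparr>"

definition rat_vector_group :: "(rat ^ 'n) monoid" where
  "rat_vector_group = \<lparr>carrier = UNIV, monoid.mult = (+), one = 0\<rparr>"

end

theory Submission
  imports Defs
begin

text \<open>
  The subgroup \<open>\<rat>\<^sup>n\<close> is the set of divisible elements, so every automorphism \<open>\<phi>\<close> restricts to a
  \<open>\<rat>\<close>-linear bijection \<open>N\<close> of it and induces \<open>e = \<plusminus>1\<close> on the quotient \<open>\<int>\<close>. If \<open>e = 1\<close>, the
  \<open>\<int>\<close>-coordinate is a class invariant and there are infinitely many classes. If \<open>e = -1\<close>, then
  \<open>N = M N M\<close>, only the parity of the \<open>\<int>\<close>-coordinate is invariant, and the classes of even and odd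
  elements correspond to the cokernels of \<open>1 - N\<close> and \<open>1 - M N\<close> on \<open>\<rat>\<^sup>n\<close>, each of which is either
  trivial or infinite. Conversely every invertible \<open>N\<close> with \<open>N = M N M\<close> is realised by the
  automorphism \<open>(a, h) \<mapsto> (N a, -h)\<close>.
\<close>

section \<open>Twisted conjugacy classes\<close>

lemma (in group) equiv_reidemeister_rel:
  assumes \<phi>: "\<phi> \<in> hom G G"
  shows "equiv (carrier G) (reidemeister_rel G \<phi>)"
proof -
  interpret \<phi>: group_hom G G \<phi>
    using \<phi> by unfold_locales
  show ?thesis
  proof (intro equivI refl_onI symI transI)
    show "reidemeister_rel G \<phi> \<subseteq> carrier G \<times> carrier G"
      by (auto simp: reidemeister_rel_def)
  next
    fix x assume "x \<in> carrier G"
    then show "(x, x) \<in> reidemeister_rel G \<phi>"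
      by (auto simp: reidemeister_rel_def intro!: bexI[of _ \<one>])
  next
    fix x y assume "(x, y) \<in> reidemeister_rel G \<phi>"
    then obtain g where g: "g \<in> carrier G" "x \<in> carrier G" and y: "y = g \<otimes> x \<otimes> \<phi> (inv g)"
      by (auto simp: reidemeister_rel_def)
    have "x = inv g \<otimes> y \<otimes> \<phi> (inv (inv g))"
      using g by (simp add: y m_assoc \<phi>.hom_inv) (simp add: m_assoc[symmetric])
    then show "(y, x) \<in> reidemeister_rel G \<phi>"
      using g y by (auto simp: reidemeister_rel_def intro!: bexI[of _ "inv g"])
  next
    fix x y z assume "(x, y) \<in> reidemeister_rel G \<phi>" "(y, z) \<in> reidemeister_rel G \<phi>"
    then obtain g h where g: "g \<in> carrier G" "h \<in> carrier G" "x \<in> carrier G"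
      and z: "z = h \<otimes> (g \<otimes> x \<otimes> \<phi> (inv g)) \<otimes> \<phi> (inv h)"
      by (auto simp: reidemeister_rel_def)
    have "z = (h \<otimes> g) \<otimes> x \<otimes> \<phi> (inv (h \<otimes> g))"
      using g by (simp add: z m_assoc inv_mult_group \<phi>.hom_mult)
    then show "(x, z) \<in> reidemeister_rel G \<phi>"
      using g z by (auto simp: reidemeister_rel_def intro!: bexI[of _ "h \<otimes> g"])
  qed
qed

text \<open>The classes of the \<open>f i\<close> are pairwise distinct, so \<open>I\<close> injects
  into the quotient.\<close>

lemma (in group) reidemeister_number_infinite:
  assumes \<phi>: "\<phi> \<in> hom G G" and "infinite I" and f: "\<And>i. i \<in> I \<Longrightarrow> f i \<in> carrier G"
    and sep: "\<And>i j. i \<in> I \<Longrightarrow> j \<in> I \<Longrightarrow> (f i, f j) \<in> reidemeister_rel G \<phi> \<Longrightarrow> i = j"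
  shows "reidemeister_number G \<phi> = \<infinity>"
proof -
  let ?R = "reidemeister_rel G \<phi>"
  have "inj_on (\<lambda>i. ?R `` {f i}) I"
    using sep f eq_equiv_class_iff[OF equiv_reidemeister_rel[OF \<phi>]] by (auto intro!: inj_onI)
  moreover have "(\<lambda>i. ?R `` {f i}) ` I \<subseteq> carrier G // ?R"
    using f by (auto intro: quotientI)
  ultimately have "infinite (carrier G // ?R)"
    using \<open>infinite I\<close> inj_on_finite by blast
  then show ?thesis
    by (simp add: reidemeister_number_def)
qed

lemma (in group) reidemeister_number_2:
  assumes \<phi>: "\<phi> \<in> hom G G" and xy: "x \<in> carrier G" "y \<in> carrier G"
    and sep: "(x, y) \<notin> reidemeister_rel G \<phi>"
    and cov: "\<And>z. z \<in> carrier G \<Longrightarrow>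
      (x, z) \<in> reidemeister_rel G \<phi> \<or> (y, z) \<in> reidemeister_rel G \<phi>"
  shows "reidemeister_number G \<phi> = 2"
proof -
  let ?R = "reidemeister_rel G \<phi>"
  note eq = eq_equiv_class_iff[OF equiv_reidemeister_rel[OF \<phi>]]
  have "?R `` {z} \<in> {?R `` {x}, ?R `` {y}}" if "z \<in> carrier G" for z
    using cov[OF that] eq[OF xy(1) that] eq[OF xy(2) that] by auto
  then have "carrier G // ?R = {?R `` {x}, ?R `` {y}}"
    using xy by (auto simp: quotient_def)
  moreover have "?R `` {x} \<noteq> ?R `` {y}"
    using sep xy eq by blast
  ultimately show ?thesis
    by (simp add: reidemeister_number_def numeral_eq_enat)
qed

section \<open>Additive maps on rational vector spaces\<close>

text \<open>The codomain is a ring so that both integer-valued maps and the coordinates of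
  vector-valued maps are covered.\<close>

lemma additive_of_nat:
  fixes f :: "rat ^ 'n \<Rightarrow> 'b :: ring_1"
  assumes "\<And>a b. f (a + b) = f a + f b"
  shows "f (of_nat m *s a) = of_nat m * f a"
proof (induction m)
  case 0
  show ?case using assms[of 0 0] by simp
next
  case (Suc m)
  then show ?case by (simp add: vector_sadd_rdistrib assms distrib_right)
qed

text \<open>Divisibility of \<open>rat ^ 'n\<close>: \<open>f a\<close> is a multiple of every
  positive integer, in particular of one exceeding its absolute value.\<close>

lemma additive_vec_to_int_zero:
  fixes f :: "rat ^ 'n \<Rightarrow> int"
  assumes "\<And>a b. f (a + b) = f a + f b"
  shows "f a = 0"
proof -
  define m where "m = Suc (nat \<bar>f a\<bar>)"
  have "f a = f (of_nat m *s ((1 / of_nat m) *s a))"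
    by (simp add: m_def vector_smult_assoc del: of_nat_Suc)
  also have "\<dots> = int m * f ((1 / of_nat m) *s a)"
    by (rule additive_of_nat) (rule assms)
  finally have "int m dvd f a"
    by (metis dvd_triv_left)
  then show ?thesis
    using zdvd_imp_le[of "int m" "\<bar>f a\<bar>"] by (force simp: m_def)
qed

text \<open>Homogeneity passes from naturals to integers by oddness, and then to fractions
  \<open>u / v\<close> by multiplying with \<open>v\<close> and cancelling.\<close>

lemma additive_imp_linear:
  fixes f :: "rat ^ 'n \<Rightarrow> rat ^ 'm"
  assumes add: "\<And>a b. f (a + b) = f a + f b"
  shows "Vector_Spaces.linear (*s) (*s) f"
proof -
  have nat: "f (of_nat m *s a) = of_nat m *s f a" for m a
    unfolding vec_eq_iff
    by (auto simp: add additive_of_nat[where f = "\<lambda>a. f a $ i" for i])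
  have f0: "f 0 = 0"
    using add[of 0 0] by simp
  have neg: "f (- a) = - f a" for a
    using add[of a "- a"] f0 by (simp add: eq_neg_iff_add_eq_0 add.commute)
  have int: "f (of_int z *s a) = of_int z *s f a" for z a
  proof (cases z)
    case (nonneg m)
    then show ?thesis using nat by simp
  next
    case (neg m)
    have "f (- (of_nat (Suc m) *s a)) = - (of_nat (Suc m) *s f a)"
      unfolding \<open>\<And>a. f (- a) = - f a\<close> nat ..
    then show ?thesis
      unfolding neg of_int_minus of_int_of_nat_eq vector_smult_lneg .
  qed
  have "f (q *s a) = q *s f a" for q a
  proof -
    obtain u v where uv: "q = of_int u / of_int v" "v > 0"
      by (cases q) (auto simp: Fract_of_int_quotient)
    then have "of_int v *s f (q *s a) = f (of_int u *s a)"
      by (simp add: vector_smult_assoc flip: int)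
    also have "\<dots> = of_int v *s (q *s f a)"
      using uv by (simp add: int vector_smult_assoc)
    finally show ?thesis
      by (rule vec.scale_left_imp_eq[rotated]) (use uv(2) in simp)
  qed
  then show ?thesis
    by unfold_locales (auto simp: add vector_add_ldistrib vector_sadd_rdistrib vector_smult_assoc)
qed

text \<open>A right inverse of a square matrix is two-sided. This turns the determinant conditions
  into the vanishing of cokernels.\<close>

lemma det_nonzero_iff_surj:
  fixes A :: "'a :: field ^ 'n ^ 'n"
  shows "det A \<noteq> 0 \<longleftrightarrow> surj ((*v) A)"
  by (metis invertible_det_nz invertible_right_inverse matrix_right_invertible_surjective)

section \<open>The semidirect product\<close>

lemma auto_rat_vector_group_iff:
  fixes f :: "rat ^ 'n \<Rightarrow> rat ^ 'n"
  shows "f \<in> auto rat_vector_group \<longleftrightarrow> (\<forall>a b. f (a + b) = f a + f b) \<and> bij f"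
  by (auto simp: auto_def hom_def Bij_def rat_vector_group_def)

locale int_action =
  fixes \<theta> :: "int \<Rightarrow> rat ^ 'n \<Rightarrow> rat ^ 'n"
  assumes action_hom: "\<theta> \<in> hom integer_group (AutoGroup rat_vector_group)"
begin

abbreviation G :: "((rat ^ 'n) \<times> int) monoid"
  where "G \<equiv> semidirect_product rat_vector_group integer_group \<theta>"

lemma action_auto: "\<theta> h \<in> auto rat_vector_group"
  using action_hom by (auto simp: hom_def AutoGroup_def)

lemma action_add: "\<theta> h (a + b) = \<theta> h a + \<theta> h b"
  using action_auto by (auto simp: auto_rat_vector_group_iff)

lemma action_action: "\<theta> h (\<theta> k a) = \<theta> (h + k) a"
proof -
  have "\<theta> (h + k) = \<theta> h \<otimes>\<^bsub>AutoGroup rat_vector_group\<^esub> \<theta> k"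
    using action_hom by (auto simp: hom_def)
  moreover have "\<theta> h' \<in> Bij UNIV" for h'
    using action_auto[of h'] by (auto simp: auto_def rat_vector_group_def)
  ultimately show ?thesis
    by (simp add: AutoGroup_def BijGroup_def rat_vector_group_def compose_def)
qed

lemma action_0 [simp]: "\<theta> 0 a = a"
proof -
  \<comment> \<open>\<open>\<theta> 0\<close> is idempotent, so injectivity makes it the
    identity.\<close>
  have "inj (\<theta> 0)"
    using action_auto[of 0] by (simp add: auto_rat_vector_group_iff bij_is_inj)
  then show ?thesis
    using action_action[of 0 0 a] by (simp add: inj_eq)
qed

lemma action_linear: "Vector_Spaces.linear (*s) (*s) (\<theta> h)"
  by (rule additive_imp_linear) (rule action_add)

lemma action_zero [simp]: "\<theta> h 0 = 0"
  using action_add[of h 0 0] by simp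

lemma action_minus: "\<theta> h (- a) = - \<theta> h a"
  using action_add[of h a "- a"] by (simp add: eq_neg_iff_add_eq_0 add.commute)

lemma carrier_G [simp]: "carrier G = UNIV"
  by (simp add: semidirect_product_def rat_vector_group_def)

lemma mult_G [simp]: "(a, h) \<otimes>\<^bsub>G\<^esub> (b, k) = (a + \<theta> h b, h + k)"
  by (simp add: semidirect_product_def rat_vector_group_def)

lemma one_G [simp]: "\<one>\<^bsub>G\<^esub> = (0, 0)"
  by (simp add: semidirect_product_def rat_vector_group_def)

sublocale G: group G
proof (rule groupI)
  fix x :: "(rat ^ 'n) \<times> int"
  obtain a h where "x = (a, h)" by (cases x)
  \<comment> \<open>This is the solution \<open>(b, k)\<close> of
    \<open>b + \<theta> k a = 0\<close> and \<open>k + h = 0\<close>.\<close>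
  then have "(- \<theta> (- h) a, - h) \<otimes>\<^bsub>G\<^esub> x = \<one>\<^bsub>G\<^esub>"
    by simp
  then show "\<exists>y\<in>carrier G. y \<otimes>\<^bsub>G\<^esub> x = \<one>\<^bsub>G\<^esub>"
    by (intro bexI) auto
qed (auto simp: action_add action_action add_ac split_paired_all)

lemma inv_G [simp]: "inv\<^bsub>G\<^esub> (a, h) = (- \<theta> (- h) a, - h)"
  by (rule G.inv_equality) auto

section \<open>Structure of the automorphisms\<close>

lemma auto_G_iff:
  "\<phi> \<in> auto G \<longleftrightarrow> (\<forall>x y. \<phi> (x \<otimes>\<^bsub>G\<^esub> y) = \<phi> x \<otimes>\<^bsub>G\<^esub> \<phi> y) \<and> bij \<phi>"
  by (auto simp: auto_def hom_def Bij_def)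

text \<open>On \<open>rat ^ 'n\<close> the second coordinate of \<open>\<phi>\<close> is additive
  into the integers, hence zero, so this subgroup is preserved; \<open>e\<close> describes the map
  induced on the quotient, and surjectivity makes it a unit. The translation part \<open>c\<close>
  can be arbitrary.\<close>

lemma auto_decompose:
  assumes \<phi>: "\<phi> \<in> auto G"
  obtains \<nu> c e where "e = 1 \<or> e = - 1" "\<And>a h. snd (\<phi> (a, h)) = e * h"
    "\<And>a. \<phi> (a, 0) = (\<nu> a, 0)" "\<phi> (0, 1) = (c, e)"
    "Vector_Spaces.linear (*s) (*s) \<nu>" "bij \<nu>"
    "\<And>a. \<nu> (\<theta> 1 a) = \<theta> e (\<nu> a)"
proof
  have hom: "\<phi> (x \<otimes>\<^bsub>G\<^esub> y) = \<phi> x \<otimes>\<^bsub>G\<^esub> \<phi> y" for x y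
    using \<phi> unfolding auto_G_iff by blast
  have bij: "bij \<phi>"
    using \<phi> by (auto simp: auto_G_iff)
  have snd_mult: "snd (x \<otimes>\<^bsub>G\<^esub> y) = snd x + snd y" for x y
    by (cases x, cases y) simp
  have snd_hom: "snd (\<phi> (x \<otimes>\<^bsub>G\<^esub> y)) = snd (\<phi> x) + snd (\<phi> y)" for x y
    by (simp add: hom snd_mult)
  define \<nu> where "\<nu> = (\<lambda>a. fst (\<phi> (a, 0)))"
  define c where "c = fst (\<phi> (0, 1))"
  define e where "e = snd (\<phi> (0, 1))"
  have snd0: "snd (\<phi> (a, 0)) = 0" for a
    by (rule additive_vec_to_int_zero[of "\<lambda>a. snd (\<phi> (a, 0))"])
      (use snd_hom[of "(_, 0)" "(_, 0)"] in simp)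
  show \<phi>0: "\<phi> (a, 0) = (\<nu> a, 0)" for a
    using snd0 by (simp add: \<nu>_def prod_eq_iff)
  show \<phi>1: "\<phi> (0, 1) = (c, e)"
    by (simp add: c_def e_def)
  have snd_add: "snd (\<phi> (0, h + k)) = snd (\<phi> (0, h)) + snd (\<phi> (0, k))" for h k
    using snd_hom[of "(0, h)" "(0, k)"] by simp
  have "snd (\<phi> (0, h)) = e * h" for h
  proof (induction h rule: int_induct[where k = 0])
    case base
    show ?case using snd0 by simp
  next
    case (step1 i)
    then show ?case by (simp add: snd_add e_def algebra_simps)
  next
    case (step2 i)
    then show ?case using snd_add[of "i - 1" 1] by (simp add: e_def algebra_simps)
  qed
  then show snd_\<phi>: "snd (\<phi> (a, h)) = e * h" for a h
    using snd_hom[of "(a, 0)" "(0, h)"] snd0 by simp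
  obtain x where "\<phi> x = (0, 1)"
    using bij by (metis bij_pointE)
  then have "e * snd x = 1"
    using snd_\<phi>[of "fst x" "snd x"] by simp
  then show e: "e = 1 \<or> e = - 1"
    by (auto simp: zmult_eq_1_iff)
  have "\<nu> (a + b) = \<nu> a + \<nu> b" for a b
    using hom[of "(a, 0)" "(b, 0)"] by (simp add: \<phi>0)
  then show "Vector_Spaces.linear (*s) (*s) \<nu>"
    by (rule additive_imp_linear)
  show "bij \<nu>"
  proof (rule bijI)
    show "inj \<nu>"
    proof (rule injI)
      fix a b assume "\<nu> a = \<nu> b"
      then have "\<phi> (a, 0) = \<phi> (b, 0)" by (simp add: \<phi>0)
      then show "a = b" using bij by (simp add: bij_is_inj inj_eq)
    qed
    \<comment> \<open>A preimage of \<open>(b, 0)\<close> has integer coordinate \<open>0\<close>,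
      because \<open>e * h = 0\<close> and \<open>e\<close> is a unit.\<close>
    have "\<exists>a. b = \<nu> a" for b
    proof -
      obtain a h where "\<phi> (a, h) = (b, 0)"
        using bij by (metis bij_pointE surj_pair)
      moreover from this have "h = 0"
        using snd_\<phi>[of a h] e by auto
      ultimately show ?thesis by (auto simp: \<phi>0)
    qed
    then show "surj \<nu>" by (auto simp: surj_def)
  qed
  show "\<nu> (\<theta> 1 a) = \<theta> e (\<nu> a)" for a
  proof -
    \<comment> \<open>Conjugation by \<open>(0, 1)\<close> acts as \<open>\<theta> 1\<close>.
      Applying \<open>\<phi>\<close> to this relation and cancelling \<open>c\<close> gives the
      claim.\<close>
    have "(0, 1) \<otimes>\<^bsub>G\<^esub> (a, 0) = (\<theta> 1 a, 0) \<otimes>\<^bsub>G\<^esub> (0, 1)"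
      by simp
    then have "\<phi> (0, 1) \<otimes>\<^bsub>G\<^esub> \<phi> (a, 0) = \<phi> (\<theta> 1 a, 0) \<otimes>\<^bsub>G\<^esub> \<phi> (0, 1)"
      by (metis hom)
    then show ?thesis by (simp add: \<phi>0 \<phi>1)
  qed
qed

section \<open>Reidemeister numbers for the two signs of \<open>e\<close>\<close>

lemma reidemeister_number_orientation_preserving:
  assumes \<phi>: "\<phi> \<in> hom G G" and snd_\<phi>: "\<And>x. snd (\<phi> x) = snd x"
  shows "reidemeister_number G \<phi> = \<infinity>"
proof (rule G.reidemeister_number_infinite[OF \<phi>, where I = UNIV and f = "\<lambda>h :: int. (0, h)"])
  fix h k :: int
  assume "((0, h), (0, k)) \<in> reidemeister_rel G \<phi>"
  then obtain g where "(0, k) = g \<otimes>\<^bsub>G\<^esub> (0, h) \<otimes>\<^bsub>G\<^esub> \<phi> (inv\<^bsub>G\<^esub> g)"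
    by (auto simp: reidemeister_rel_def)
  \<comment> \<open>The contributions of \<open>g\<close> and of \<open>\<phi> (inv g)\<close> to
    the integer coordinate cancel.\<close>
  then show "h = k"
    using snd_\<phi>[of "inv\<^bsub>G\<^esub> g"] by (cases g; cases "\<phi> (inv\<^bsub>G\<^esub> g)") auto
qed (auto simp: infinite_UNIV_int)

text \<open>Twisting by \<open>(a, k)\<close> changes the level (the integer coordinate) by
  \<open>2 * k\<close>, so staying on a level forces \<open>k = 0\<close>; the remaining elements
  \<open>(a, 0)\<close> act on it by translations.\<close>

lemma reidemeister_rel_same_level:
  assumes \<phi>0: "\<And>a. \<phi> (a, 0) = (\<nu> a, 0)" and snd_\<phi>: "\<And>x. snd (\<phi> x) = - snd x"
  shows "((x, h), (y, h)) \<in> reidemeister_rel G \<phi> \<longleftrightarrow> (\<exists>a. y - x = a + \<theta> h (\<nu> (- a)))"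
proof
  assume "((x, h), (y, h)) \<in> reidemeister_rel G \<phi>"
  then obtain a k where g: "(y, h) = (a, k) \<otimes>\<^bsub>G\<^esub> (x, h) \<otimes>\<^bsub>G\<^esub> \<phi> (inv\<^bsub>G\<^esub> (a, k))"
    by (auto simp: reidemeister_rel_def)
  have "k = 0"
    using g snd_\<phi>[of "inv\<^bsub>G\<^esub> (a, k)"] by (cases "\<phi> (inv\<^bsub>G\<^esub> (a, k))") auto
  with g show "\<exists>a. y - x = a + \<theta> h (\<nu> (- a))"
    by (auto simp: \<phi>0 algebra_simps intro!: exI[of _ a])
next
  assume "\<exists>a. y - x = a + \<theta> h (\<nu> (- a))"
  then obtain a where "y - x = a + \<theta> h (\<nu> (- a))" ..
  then have "(y, h) = (a, 0) \<otimes>\<^bsub>G\<^esub> (x, h) \<otimes>\<^bsub>G\<^esub> \<phi> (inv\<^bsub>G\<^esub> (a, 0))"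
    by (simp add: \<phi>0 algebra_simps)
  then show "((x, h), (y, h)) \<in> reidemeister_rel G \<phi>"
    unfolding reidemeister_rel_def carrier_G by blast
qed

text \<open>Every element can be moved to level \<open>0\<close> or \<open>1\<close>, and on each of
  these equivalence means lying in the same coset of the range of a linear map. The first coordinate
  of \<open>\<phi> (0, 1)\<close> does not affect these ranges.\<close>

lemma reidemeister_number_orientation_reversing:
  assumes \<phi>: "\<phi> \<in> hom G G"
    and \<phi>0: "\<And>a. \<phi> (a, 0) = (N *v a, 0)" and snd_\<phi>: "\<And>x. snd (\<phi> x) = - snd x"
  shows "reidemeister_number G \<phi> =
    (if det (mat 1 - N) \<noteq> 0 \<and> det (mat 1 - matrix (\<theta> 1) ** N) \<noteq> 0 then 2 else \<infinity>)"
proof -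
  let ?R = "reidemeister_rel G \<phi>"
  note equiv = G.equiv_reidemeister_rel[OF \<phi>]
  \<comment> \<open>By \<open>reidemeister_rel_same_level\<close>, the range of \<open>A h\<close>
    is the set of differences of equivalent elements on level \<open>h\<close>.\<close>
  define A where "A h = mat 1 - matrix (\<theta> h) ** N" for h
  have A: "A h *v a = a + \<theta> h (N *v (- a))" for h a
    using matrix_vector_mult_diff_distrib[of N 0 a]
    by (simp add: A_def matrix_vector_mult_diff_rdistrib matrix_vector_mul_assoc[symmetric]
        matrix_works[OF action_linear] action_minus)
  have level: "((x, h), (y, h)) \<in> ?R \<longleftrightarrow> y - x \<in> range ((*v) (A h))" for x y h
    using reidemeister_rel_same_level[of \<phi> "(*v) N", OF \<phi>0 snd_\<phi>, of x h y]
    by (auto simp: image_iff A)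
  have "matrix (\<theta> 0) = mat 1"
    using matrix_id_mat_1 by (metis action_0 eq_id_iff)
  then have dets: "det (mat 1 - N) = det (A 0)" "det (mat 1 - matrix (\<theta> 1) ** N) = det (A 1)"
    by (simp_all add: A_def)
  \<comment> \<open>The range is a subspace: if it misses \<open>v\<close>, it misses every nonzero
    multiple of \<open>v\<close>, so the points \<open>(q *s v, h)\<close> for rational
    \<open>q\<close> lie in distinct classes.\<close>
  have infin: "reidemeister_number G \<phi> = \<infinity>" if not_surj: "det (A h) = 0" for h
  proof -
    obtain v where v: "v \<notin> range ((*v) (A h))"
      using not_surj det_nonzero_iff_surj[of "A h"] by auto
    show ?thesis
    proof (rule G.reidemeister_number_infinite[OF \<phi>, where I = UNIV and f = "\<lambda>q. (q *s v, h)"])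
      fix p q :: rat
      assume "((p *s v, h), (q *s v, h)) \<in> ?R"
      then obtain a where a: "(q - p) *s v = A h *v a"
        by (auto simp: level vector_sub_rdistrib)
      show "p = q"
      proof (rule ccontr)
        assume "p \<noteq> q"
        then have "v = (1 / (q - p)) *s ((q - p) *s v)"
          by (simp add: vector_smult_assoc del: vector_sub_rdistrib)
        also have "\<dots> = A h *v ((1 / (q - p)) *s a)"
          by (simp only: a vector_scalar_commute)
        finally show False using v by blast
      qed
    qed (auto simp: infinite_UNIV_char_0)
  qed
  have two: "reidemeister_number G \<phi> = 2" if surj: "det (A 0) \<noteq> 0" "det (A 1) \<noteq> 0"
  proof (rule G.reidemeister_number_2[OF \<phi>, where x = "(0, 0)" and y = "(0, 1)"])
    show "((0, 0), (0, 1)) \<notin> ?R"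
    proof
      assume "((0, 0), (0, 1)) \<in> ?R"
      then obtain g where g: "(0, 1) = g \<otimes>\<^bsub>G\<^esub> (0, 0) \<otimes>\<^bsub>G\<^esub> \<phi> (inv\<^bsub>G\<^esub> g)"
        by (auto simp: reidemeister_rel_def)
      \<comment> \<open>Twisting the identity element by \<open>g\<close> yields level
        \<open>2 * snd g\<close>, which is even.\<close>
      then have "1 = 2 * snd g"
        using snd_\<phi>[of "inv\<^bsub>G\<^esub> g"] by (cases g; cases "\<phi> (inv\<^bsub>G\<^esub> g)") auto
      then show False by presburger
    qed
  next
    fix z :: "(rat ^ 'n) \<times> int"
    obtain x h where z: "z = (x, h)" by (cases z)
    \<comment> \<open>Twisting by this \<open>g\<close> lowers the level by
      \<open>2 * (h div 2)\<close>, leaving \<open>h mod 2\<close>.\<close>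
    define g where "g = (0 :: rat ^ 'n, - (h div 2))"
    define w where "w = g \<otimes>\<^bsub>G\<^esub> z \<otimes>\<^bsub>G\<^esub> \<phi> (inv\<^bsub>G\<^esub> g)"
    have "(z, w) \<in> ?R"
      unfolding reidemeister_rel_def w_def carrier_G by blast
    then have wz: "(w, z) \<in> ?R"
      using equiv by (meson equivE symE)
    have "snd w = h mod 2"
      using snd_\<phi>[of "inv\<^bsub>G\<^esub> g"] by (cases "\<phi> (inv\<^bsub>G\<^esub> g)") (simp_all add: w_def g_def z minus_mult_div_eq_mod)
    \<comment> \<open>Surjectivity of \<open>A k\<close> makes all elements of level
      \<open>k\<close> equivalent.\<close>
    moreover have "((0, k), (y, k)) \<in> ?R" if "k = 0 \<or> k = 1" for k y
      using that surj det_nonzero_iff_surj[of "A k"] by (auto simp: level)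
    moreover have parity: "h mod 2 = 0 \<or> h mod 2 = 1"
      by presburger
    ultimately have "((0, h mod 2), w) \<in> ?R"
      by (cases w) simp
    then have "((0, h mod 2), z) \<in> ?R"
      using wz equiv by (meson equivE transE)
    then show "((0, 0), z) \<in> ?R \<or> ((0, 1), z) \<in> ?R"
      using parity by (elim disjE) (simp_all only: simp_thms)
  qed auto
  show ?thesis
    unfolding dets using infin two by auto
qed

section \<open>The values in the spectrum\<close>

lemma infinity_in_spectrum: "\<infinity> \<in> reidemeister_spectrum G"
proof -
  \<comment> \<open>The identity keeps the integer coordinate, so it always contributes
    \<infinity>.\<close>
  have "(\<lambda>x. x) \<in> auto G"
    using bij_id by (simp add: auto_G_iff id_def)
  moreover have "reidemeister_number G (\<lambda>x. x) = \<infinity>"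
    by (rule reidemeister_number_orientation_preserving) (auto simp: hom_def)
  ultimately show ?thesis
    unfolding reidemeister_spectrum_def by force
qed

text \<open>A finite number excludes \<open>e = 1\<close>. For \<open>e = - 1\<close> the relation
  from \<open>auto_decompose\<close> reads
  \<open>\<nu> (\<theta> 1 a) = \<theta> (- 1) (\<nu> a)\<close>, and applying
  \<open>\<theta> 1\<close> turns it into \<open>N = M ** N ** M\<close>.\<close>

lemma reidemeister_number_auto:
  assumes \<phi>: "\<phi> \<in> auto G" and fin: "reidemeister_number G \<phi> \<noteq> \<infinity>"
  defines "M \<equiv> matrix (\<theta> 1)"
  shows "reidemeister_number G \<phi> = 2 \<and>
    (\<exists>N. invertible N \<and> N = M ** N ** M \<and> det (mat 1 - N) \<noteq> 0 \<and> det (mat 1 - M ** N) \<noteq> 0)"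
proof -
  obtain \<nu> c e where e: "e = 1 \<or> e = - 1" and snd_\<phi>: "\<And>a h. snd (\<phi> (a, h)) = e * h"
    and \<phi>0: "\<And>a. \<phi> (a, 0) = (\<nu> a, 0)"
    and lin: "Vector_Spaces.linear (*s) (*s) \<nu>" and bij: "bij \<nu>"
    and comm: "\<And>a. \<nu> (\<theta> 1 a) = \<theta> e (\<nu> a)"
    by (rule auto_decompose[OF \<phi>]) metis
  have hom: "\<phi> \<in> hom G G"
    using \<phi> by (auto simp: auto_def)
  have "e \<noteq> 1"
    using reidemeister_number_orientation_preserving[OF hom] fin snd_\<phi> by auto
  with e have e: "e = - 1" by simp
  define N where "N = matrix \<nu>"
  have N: "N *v a = \<nu> a" for a
    by (simp add: N_def matrix_works lin)
  have M: "M *v a = \<theta> 1 a" for a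
    by (simp add: M_def matrix_works action_linear)
  have "N = M ** N ** M"
    by (simp add: matrix_eq matrix_vector_mul_assoc[symmetric] M N comm e action_action)
  moreover have "invertible N"
  proof -
    have "(*v) N = \<nu>" using N by auto
    then show ?thesis using bij by (simp add: invertible_eq_bij)
  qed
  moreover have "reidemeister_number G \<phi> =
      (if det (mat 1 - N) \<noteq> 0 \<and> det (mat 1 - M ** N) \<noteq> 0 then 2 else \<infinity>)"
    unfolding M_def
    by (rule reidemeister_number_orientation_reversing[OF hom]) (auto simp: \<phi>0 N snd_\<phi> e)
  ultimately show ?thesis
    using fin by (auto split: if_splits)
qed

text \<open>The assumption is \<open>N = M ** N ** M\<close> written for maps; it gives the case
  \<open>h = 1\<close>, and induction in both directions gives the rest. The result is what
  multiplicativity of \<open>(a, h) \<mapsto> (\<nu> a, - h)\<close> requires.\<close>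

lemma action_conjugate:
  assumes "\<And>a. \<theta> 1 (\<nu> (\<theta> 1 a)) = \<nu> a"
  shows "\<nu> (\<theta> h a) = \<theta> (- h) (\<nu> a)"
proof (induction h arbitrary: a rule: int_induct[where k = 0])
  case base
  show ?case by simp
next
  have step: "\<nu> (\<theta> 1 b) = \<theta> (- 1) (\<nu> b)" for b
    using arg_cong[OF assms[of b], of "\<theta> (- 1)"] by (simp add: action_action)
  {
    case (step1 i)
    have "\<nu> (\<theta> (i + 1) a) = \<theta> (- 1) (\<nu> (\<theta> i a))"
      by (simp add: action_action add.commute flip: step)
    then show ?case by (simp add: step1 action_action algebra_simps)
  next
    case (step2 i)
    have "\<nu> (\<theta> (i - 1) a) = \<theta> 1 (\<nu> (\<theta> i a))"
      using assms[of "\<theta> (i - 1) a"] by (simp add: action_action)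
    then show ?case by (simp add: step2 action_action algebra_simps)
  }
qed

lemma two_in_spectrum:
  defines "M \<equiv> matrix (\<theta> 1)"
  assumes "invertible N" and N: "N = M ** N ** M"
    and det: "det (mat 1 - N) \<noteq> 0" "det (mat 1 - M ** N) \<noteq> 0"
  shows "2 \<in> reidemeister_spectrum G"
proof -
  \<comment> \<open>In the notation of \<open>auto_decompose\<close>, this is the choice
    \<open>e = - 1\<close> and \<open>c = 0\<close>.\<close>
  define \<phi> where "\<phi> = (\<lambda>(a, h :: int). (N *v a, - h))"
  have bij_N: "bij ((*v) N)"
    using \<open>invertible N\<close> by (simp add: invertible_eq_bij)
  have "\<theta> 1 (N *v (\<theta> 1 a)) = N *v a" for a
    using arg_cong[OF N, of "\<lambda>A. A *v a"]
    by (simp add: M_def matrix_vector_mul_assoc[symmetric] matrix_works[OF action_linear])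
  then have "N *v \<theta> h a = \<theta> (- h) (N *v a)" for h a
    by (rule action_conjugate)
  then have hom: "\<phi> (x \<otimes>\<^bsub>G\<^esub> y) = \<phi> x \<otimes>\<^bsub>G\<^esub> \<phi> y" for x y
    by (cases x, cases y) (simp add: \<phi>_def matrix_vector_right_distrib)
  have "\<phi> = map_prod ((*v) N) uminus"
    by (auto simp: \<phi>_def)
  then have "bij \<phi>"
    using bij_betw_map_prod[OF bij_N, of uminus UNIV UNIV] bij_uminus by simp
  with hom have "\<phi> \<in> auto G"
    by (auto simp: auto_G_iff)
  moreover have "reidemeister_number G \<phi> = 2"
  proof (subst reidemeister_number_orientation_reversing)
    show "\<phi> \<in> hom G G" using hom by (auto simp: hom_def)
  qed (use det in \<open>auto simp: \<phi>_def M_def\<close>)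
  ultimately show ?thesis
    unfolding reidemeister_spectrum_def by force
qed

end

theorem proposition4p1:
  fixes \<theta> :: "int \<Rightarrow> rat ^ 'n \<Rightarrow> rat ^ 'n"
    and M :: "rat ^ 'n ^ 'n"
  assumes "CARD('n) > 2"
    and "\<theta> \<in> hom integer_group (AutoGroup rat_vector_group)"
    and "M = matrix (\<theta> 1)"
  defines "S \<equiv> reidemeister_spectrum (semidirect_product rat_vector_group integer_group \<theta>)"
  shows "(S = {\<infinity>} \<or> S = {2} \<union> {\<infinity>}) \<and>
    ((\<nexists>N :: rat ^ 'n ^ 'n. invertible N \<and> N = M ** N ** M \<and>
          det (mat 1 - N) \<noteq> 0 \<and> det (mat 1 - M ** N) \<noteq> 0) \<longrightarrow> S = {\<infinity>}) \<and>
    ((\<exists>N :: rat ^ 'n ^ 'n. invertible N \<and> N = M ** N ** M \<and>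
          det (mat 1 - N) \<noteq> 0 \<and> det (mat 1 - M ** N) \<noteq> 0) \<longrightarrow> S = {2} \<union> {\<infinity>})"
proof -
  interpret int_action \<theta>
    by unfold_locales (rule assms(2))
  let ?P = "\<exists>N :: rat ^ 'n ^ 'n. invertible N \<and> N = M ** N ** M \<and>
          det (mat 1 - N) \<noteq> 0 \<and> det (mat 1 - M ** N) \<noteq> 0"
  have inf: "\<infinity> \<in> S"
    unfolding S_def by (rule infinity_in_spectrum)
  \<comment> \<open>A finite value yields a matrix \<open>N\<close>. So without such an
    \<open>N\<close> only \<infinity> remains, and with one the only other value is
    \<open>2\<close>.\<close>
  have sub: "s = \<infinity> \<or> s = 2 \<and> ?P" if "s \<in> S" for s
    using that reidemeister_number_auto unfolding S_def reidemeister_spectrum_def assms(3) by blast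
  have two: "2 \<in> S" if ?P
    using that two_in_spectrum unfolding S_def assms(3) by blast
  have "S = {\<infinity>}" if "\<not> ?P"
    using inf sub that by blast
  moreover have "S = {2} \<union> {\<infinity>}" if ?P
    using inf sub two[OF that] by blast
  ultimately show ?thesis by blast
qed

end
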